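(* Every polyregular function is equal to a finite composition of transductions each specified by an HDT0L system.
   Context: Register transducer $\Gamma^*\to\Sigma^*$ (finite alphabets): a finite set $Q$ of states with initial state $q_I$, a finite set $R$ of registers disjoint from $\Gamma,\Sigma$, a transition function $\delta:Q\times\Gamma\to Q\times((\Sigma\cup R)^* )^R$ and an output function $F:Q\to(\Sigma\cup R)^*$. Configurations are pairs $(q,s)$ with $s:R\to\Sigma^*$; for $c\in\Gamma$, $(q,s)\to_c(q',s')$ when $(q',u)=\delta(q,c)$ and $s'=s^*\circ u$, where $s^*$ is the monoid morphism fixing letters of $\Sigma$ and sending $r$ to $s(r)$. The image of $w=w_1\cdots w_n$ is $s^*(F(q))$ where $(q_I,(r\mapsto\varepsilon))\to_{w_1}\cdots\to_{w_n}(q,s)$. A streaming string transducer (SST) is a register transducer such that for every update $u$ appearing in some $\delta(q,c)$ and every $r\in R$, $r$ occurs at most once in total among the words $u(r')$, $r'\in R$, and every $r$ occurs at most once in each $F(q)$. A function is regular if computed by some SST. For a finite alphabet $\Gamma$, let $\underline\Gamma=\{\underline c\mid c\in\Gamma\}$ be a disjoint copy; $\mathtt{squaring}_\Gamma:\Gamma^*\to(\Gamma\cup\underline\Gamma)^*$ maps $w=w_1\cdots w_n$ to the concatenation, for $i=1,\dots,n$, of the word $w_1\cdots w_{i-1}\underline{w_i}w_{i+1}\cdots w_n$ (e.g. $\mathtt{1234}\mapsto\mathtt{\underline{1}2341\underline{2}3412\underline{3}4123\underline{4}}$). The polyregular functions form the smallest class of string functions closed under composition containing all regular functions and all $\mathtt{squaring}_\Gamma$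 for finite $\Gamma$. An HDT0L system consists of finite alphabets $\Gamma,\Sigma,\Delta$, an initial word $d\in\Delta^*$, monoid morphisms $h_c:\Delta^*\to\Delta^*$ ($c\in\Gamma$) and $h':\Delta^*\to\Sigma^*$; it specifies $w_1\cdots w_n\mapsto h'\circ h_{w_1}\circ\cdots\circ h_{w_n}(d)$. *)

theory Defs
  imports Main "HOL-Library.Infinite_Typeclass"
begin

text \<open>
  Alphabets are finite sets of letters drawn from one type, and a string function from
  \<open>\<Gamma>\<close> to \<open>\<Sigma>\<close> is a HOL function on lists of which only the values on \<open>lists \<Gamma>\<close> matter.
  The classes below therefore relate two alphabets and a function, and they are all closed
  under changing the function outside \<open>lists \<Gamma>\<close>.  The type of letters has to be infinite for
  disjoint copies of alphabets always to exist; this is required where the classes are used.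
  States, registers and working letters are taken from \<^typ>\<open>nat\<close>, which is no restriction
  since there are only finitely many of them.
\<close>

text \<open>
  A word over \<open>\<Sigma> \<union> R\<close>, with \<open>\<Sigma>\<close> and \<open>R\<close> disjoint, is a list over the disjoint sum
  \<open>\<Sigma> <+> R\<close>: letters are tagged by \<^const>\<open>Inl\<close> and registers by \<^const>\<open>Inr\<close>.
\<close>

record ('q, 'r, 'a, 'b) register_transducer =
  states :: "'q set"
  init :: 'q
  registers :: "'r set"
  trans :: "'q \<Rightarrow> 'a \<Rightarrow> 'q \<times> ('r \<Rightarrow> ('b + 'r) list)"
  out :: "'q \<Rightarrow> ('b + 'r) list"

definition register_transducer ::
    "'a set \<Rightarrow> 'b set \<Rightarrow> ('q, 'r, 'a, 'b) register_transducer \<Rightarrow> bool" where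
  "register_transducer \<Gamma> \<Sigma> T \<longleftrightarrow>
     finite \<Gamma> \<and> finite \<Sigma> \<and> finite (states T) \<and> finite (registers T) \<and>
     init T \<in> states T \<and>
     (\<forall>q\<in>states T. \<forall>c\<in>\<Gamma>.
        fst (trans T q c) \<in> states T \<and>
        (\<forall>r\<in>registers T. snd (trans T q c) r \<in> lists (\<Sigma> <+> registers T))) \<and>
     (\<forall>q\<in>states T. out T q \<in> lists (\<Sigma> <+> registers T))"

definition subst :: "('r \<Rightarrow> 'b list) \<Rightarrow> ('b + 'r) list \<Rightarrow> 'b list" where
  "subst s w = concat (map (case_sum (\<lambda>b. [b]) s) w)"

fun step ::
    "('q, 'r, 'a, 'b) register_transducer \<Rightarrow> 'q \<times> ('r \<Rightarrow> 'b list) \<Rightarrow> 'a \<Rightarrow> 'q \<times> ('r \<Rightarrow> 'b list)"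
where
  "step T (q, s) c = (let (q', u) = trans T q c in (q', subst s \<circ> u))"

definition transducer_fun :: "('q, 'r, 'a, 'b) register_transducer \<Rightarrow> 'a list \<Rightarrow> 'b list" where
  "transducer_fun T w =
     (let (q, s) = foldl (step T) (init T, \<lambda>r. []) w in subst s (out T q))"

definition sst :: "'a set \<Rightarrow> 'b set \<Rightarrow> ('q, 'r, 'a, 'b) register_transducer \<Rightarrow> bool" where
  "sst \<Gamma> \<Sigma> T \<longleftrightarrow>
     register_transducer \<Gamma> \<Sigma> T \<and>
     (\<forall>q\<in>states T. \<forall>c\<in>\<Gamma>. \<forall>r\<in>registers T.
        (\<Sum>r'\<in>registers T. count_list (snd (trans T q c) r') (Inr r)) \<le> 1) \<and>
     (\<forall>q\<in>states T. \<forall>r\<in>registers T. count_list (out T q) (Inr r) \<le> 1)"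

definition regular :: "'a set \<Rightarrow> 'b set \<Rightarrow> ('a list \<Rightarrow> 'b list) \<Rightarrow> bool" where
  "regular \<Gamma> \<Sigma> f \<longleftrightarrow>
     (\<exists>T :: (nat, nat, 'a, 'b) register_transducer.
        sst \<Gamma> \<Sigma> T \<and> (\<forall>w\<in>lists \<Gamma>. f w = transducer_fun T w))"

text \<open>The argument \<open>und\<close> is the bijection from the alphabet to its disjoint copy.\<close>

definition squaring :: "('a \<Rightarrow> 'a) \<Rightarrow> 'a list \<Rightarrow> 'a list" where
  "squaring und w =
     concat (map (\<lambda>i. take i w @ [und (w ! i)] @ drop (Suc i) w) [0..<length w])"

inductive polyregular :: "'a set \<Rightarrow> 'a set \<Rightarrow> ('a list \<Rightarrow> 'a list) \<Rightarrow> bool" where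
  regular: "regular \<Gamma> \<Sigma> f \<Longrightarrow> polyregular \<Gamma> \<Sigma> f"
| squaring: "finite \<Gamma> \<Longrightarrow> inj_on und \<Gamma> \<Longrightarrow> und ` \<Gamma> \<inter> \<Gamma> = {} \<Longrightarrow>
    \<forall>w\<in>lists \<Gamma>. f w = squaring und w \<Longrightarrow> polyregular \<Gamma> (\<Gamma> \<union> und ` \<Gamma>) f"
| comp: "polyregular \<Gamma> \<Delta> f \<Longrightarrow> polyregular \<Delta> \<Sigma> g \<Longrightarrow>
    \<forall>w\<in>lists \<Gamma>. h w = g (f w) \<Longrightarrow> polyregular \<Gamma> \<Sigma> h"

definition word_morphism :: "'a set \<Rightarrow> 'b set \<Rightarrow> ('a list \<Rightarrow> 'b list) \<Rightarrow> bool" where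
  "word_morphism A B h \<longleftrightarrow>
     (\<forall>u\<in>lists A. h u \<in> lists B) \<and> h [] = [] \<and>
     (\<forall>u\<in>lists A. \<forall>v\<in>lists A. h (u @ v) = h u @ h v)"

record ('a, 'b, 'd) hdt0l =
  work_alphabet :: "'d set"
  init_word :: "'d list"
  morphism :: "'a \<Rightarrow> 'd list \<Rightarrow> 'd list"
  final_morphism :: "'d list \<Rightarrow> 'b list"

definition hdt0l :: "'a set \<Rightarrow> 'b set \<Rightarrow> ('a, 'b, 'd) hdt0l \<Rightarrow> bool" where
  "hdt0l \<Gamma> \<Sigma> H \<longleftrightarrow>
     finite \<Gamma> \<and> finite \<Sigma> \<and> finite (work_alphabet H) \<and>
     init_word H \<in> lists (work_alphabet H) \<and>
     (\<forall>c\<in>\<Gamma>. word_morphism (work_alphabet H) (work_alphabet H) (morphism H c)) \<and>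
     word_morphism (work_alphabet H) \<Sigma> (final_morphism H)"

text \<open>
  With \<^const>\<open>foldr\<close> the morphism of the last input letter is applied first.
\<close>

definition hdt0l_fun :: "('a, 'b, 'd) hdt0l \<Rightarrow> 'a list \<Rightarrow> 'b list" where
  "hdt0l_fun H w = final_morphism H (foldr (morphism H) w (init_word H))"

definition hdt0l_specified :: "'a set \<Rightarrow> 'b set \<Rightarrow> ('a list \<Rightarrow> 'b list) \<Rightarrow> bool" where
  "hdt0l_specified \<Gamma> \<Sigma> f \<longleftrightarrow>
     (\<exists>H :: ('a, 'b, nat) hdt0l. hdt0l \<Gamma> \<Sigma> H \<and> (\<forall>w\<in>lists \<Gamma>. f w = hdt0l_fun H w))"

inductive finite_composition ::
    "('a set \<Rightarrow> 'a set \<Rightarrow> ('a list \<Rightarrow> 'a list) \<Rightarrow> bool) \<Rightarrow>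
     'a set \<Rightarrow> 'a set \<Rightarrow> ('a list \<Rightarrow> 'a list) \<Rightarrow> bool"
  for C where
  single: "C \<Gamma> \<Sigma> f \<Longrightarrow> finite_composition C \<Gamma> \<Sigma> f"
| comp: "C \<Gamma> \<Delta> f \<Longrightarrow> finite_composition C \<Delta> \<Sigma> g \<Longrightarrow>
    \<forall>w\<in>lists \<Gamma>. h w = g (f w) \<Longrightarrow> finite_composition C \<Gamma> \<Sigma> h"

end

theory Submission
  imports Defs
begin

text \<open>
  An HDT0L system is a copyful register transducer with a single state, whose registers are the
  working letters and are initialised by the final morphism.  States can be eliminated by
  duplicating each register for each state and keeping empty the copies that do not belong to
  the current state, so every regular function is specified by an HDT0L system.  Squaring is the
  composition of two copyful transducers: the first lists, from right to left, the prefixes of the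
  input with their last letter underlined; the second restores the order and, since the
  underlined letters read so far spell out the missing suffix, completes each prefix.
\<close>

section \<open>HDT0L systems and renaming of their working letters\<close>

lemma word_morphism_concat_map:
  assumes "\<And>x. x \<in> A \<Longrightarrow> k x \<in> lists B"
  shows "word_morphism A B (\<lambda>v. concat (map k v))"
proof -
  have "concat (map k u) \<in> lists B" if "u \<in> lists A" for u
    using that assms by (induction u) auto
  then show ?thesis by (simp add: word_morphism_def)
qed

lemma foldr_morphism_in_lists:
  assumes "hdt0l \<Gamma> \<Sigma> H" "w \<in> lists \<Gamma>"
  shows "foldr (morphism H) w (init_word H) \<in> lists (work_alphabet H)"
  using assms(2)
proof (induction w)
  case Nil
  then show ?case using assms(1) by (simp add: hdt0l_def)
next
  case (Cons c w)
  then show ?case using assms(1) by (simp add: hdt0l_def word_morphism_def)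
qed

text \<open>Working letters of any type can be coded by naturals: the finite working alphabet embeds
  injectively by \<open>e\<close>, and every morphism is conjugated by \<open>e\<close> and its
  inverse \<open>g\<close>.\<close>

lemma hdt0l_specifiedI:
  fixes H :: "('a, 'b, 'd) hdt0l"
  assumes H: "hdt0l \<Gamma> \<Sigma> H" and f: "\<And>w. w \<in> lists \<Gamma> \<Longrightarrow> f w = hdt0l_fun H w"
  shows "hdt0l_specified \<Gamma> \<Sigma> f"
proof -
  define D where "D = work_alphabet H"
  have "finite D" using H by (simp add: hdt0l_def D_def)
  then obtain e :: "'d \<Rightarrow> nat" where e: "inj_on e D"
    using finite_imp_inj_to_nat_seg by blast
  define g where "g = inv_into D e"
  have ge: "g (e x) = x" if "x \<in> D" for x
    using e that by (simp add: g_def)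
  have map_ge: "map g (map e v) = v" if "v \<in> lists D" for v
    using that ge by (induction v) auto
  have map_g: "map g v \<in> lists D" if "v \<in> lists (e ` D)" for v
    using that by (induction v) (auto simp: ge)
  have map_e: "map e v \<in> lists (e ` D)" if "v \<in> lists D" for v
    using that by auto
  define K :: "('a, 'b, nat) hdt0l" where "K =
    \<lparr>work_alphabet = e ` D, init_word = map e (init_word H),
     morphism = (\<lambda>c v. map e (morphism H c (map g v))),
     final_morphism = (\<lambda>v. final_morphism H (map g v))\<rparr>"
  have "hdt0l \<Gamma> \<Sigma> K"
    unfolding hdt0l_def
  proof (intro conjI ballI)
    show "init_word K \<in> lists (work_alphabet K)"
      using H map_e by (simp add: K_def hdt0l_def D_def)
  next
    fix c assume "c \<in> \<Gamma>"
    then have "word_morphism D D (morphism H c)" using H by (simp add: hdt0l_def D_def)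
    then show "word_morphism (work_alphabet K) (work_alphabet K) (morphism K c)"
      unfolding word_morphism_def K_def using map_g map_e by simp
  next
    have "word_morphism D \<Sigma> (final_morphism H)" using H by (simp add: hdt0l_def D_def)
    then show "word_morphism (work_alphabet K) \<Sigma> (final_morphism K)"
      unfolding word_morphism_def K_def using map_g by simp
  qed (use H \<open>finite D\<close> in \<open>auto simp: hdt0l_def K_def\<close>)
  moreover have "foldr (morphism K) w (init_word K) = map e (foldr (morphism H) w (init_word H))"
    if "w \<in> lists \<Gamma>" for w
    using that
  proof (induction w)
    case (Cons c w)
    \<comment> \<open>\<open>g\<close> undoes \<open>e\<close> only on words over \<open>D\<close>,
      so the iterates must be known to stay there.\<close>
    then have "foldr (morphism H) w (init_word H) \<in> lists D"
      using foldr_morphism_in_lists[OF H] by (simp add: D_def)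
    then have "map g (foldr (morphism K) w (init_word K)) = foldr (morphism H) w (init_word H)"
      using Cons map_ge by simp
    then show ?case by (simp add: K_def)
  qed (simp add: K_def)
  then have "hdt0l_fun K w = hdt0l_fun H w" if "w \<in> lists \<Gamma>" for w
    using foldr_morphism_in_lists[OF H that] map_ge that
    by (simp add: hdt0l_fun_def K_def D_def)
  ultimately show ?thesis
    unfolding hdt0l_specified_def using f by (intro exI[of _ K]) simp
qed

section \<open>From register transducers to HDT0L systems\<close>

text \<open>The pair \<open>(p, x)\<close> is the copy of the symbol \<open>x\<close> reserved for
  state \<open>p\<close>; it is erased unless \<open>p\<close> is the current state. Output letters
  are tagged as well as registers.\<close>

fun config_value ::
    "'q \<times> ('r \<Rightarrow> 'b list) \<Rightarrow> 'q \<times> ('b + 'r) \<Rightarrow> 'b list" where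
  "config_value (q, s) (p, x) = (if p = q then case_sum (\<lambda>b. [b]) s x else [])"

lemma concat_map_singleton:
  assumes "distinct ps" "q \<in> set ps" "\<And>p. p \<in> set ps \<Longrightarrow> p \<noteq> q \<Longrightarrow> F p = []"
  shows "concat (map F ps) = F q"
proof -
  obtain xs ys where ps: "ps = xs @ q # ys"
    using assms(2) by (meson split_list)
  then have "concat (map F xs) = []" "concat (map F ys) = []"
    using assms by auto
  with ps show ?thesis by (simp only: map_append list.map concat_append concat.simps append_Nil append_Nil2)
qed

lemma concat_map_config_value_Pair:
  "concat (map (config_value (q, s)) (map (Pair p) v)) = (if p = q then subst s v else [])"
  by (induction v) (auto simp: subst_def)

lemma concat_map_concat:
  "concat (map F (concat (map G xs))) = concat (map (\<lambda>x. concat (map F (G x))) xs)"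
  by (induction xs) auto

text \<open>Evaluating \<open>h c y\<close> in a configuration amounts to evaluating
  \<open>y\<close> in the configuration reached by reading \<open>c\<close>. The forward run thus
  becomes a composition of morphisms in which the last letter acts first.\<close>

lemma register_transducer_hdt0l_specified:
  fixes T :: "('q, 'r, 'a, 'b) register_transducer"
  assumes T: "register_transducer \<Gamma> \<Sigma> T"
    and f: "\<And>w. w \<in> lists \<Gamma> \<Longrightarrow> f w = transducer_fun T w"
  shows "hdt0l_specified \<Gamma> \<Sigma> f"
proof -
  have "finite (states T)" using T by (simp add: register_transducer_def)
  then obtain qs where qs: "set qs = states T" "distinct qs"
    using finite_distinct_list by blast
  define lift where "lift u = case_sum (\<lambda>b. [Inl b]) u"
    for u :: "'r \<Rightarrow> ('b + 'r) list"
  \<comment> \<open>Transitions are followed backwards: every state \<open>q\<close> that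
    \<open>c\<close> sends to \<open>q'\<close> contributes its own tagged update of
    \<open>x\<close>. Evaluation in state \<open>q\<close> keeps only the block of
    \<open>q\<close>.\<close>
  define h where "h c = (\<lambda>(q', x). concat (map (\<lambda>q.
      if fst (trans T q c) = q' then map (Pair q) (lift (snd (trans T q c)) x) else []) qs))"
    for c
  \<comment> \<open>The initial word lists the outputs of all states, since the final state is not
    known in advance; the final morphism evaluates in the initial configuration.\<close>
  define H where "H =
    \<lparr>work_alphabet = states T \<times> (\<Sigma> <+> registers T),
     init_word = concat (map (\<lambda>q. map (Pair q) (out T q)) qs),
     morphism = (\<lambda>c v. concat (map (h c) v)),
     final_morphism = (\<lambda>v. concat (map (config_value (init T, \<lambda>r. [])) v))\<rparr>"
  have "hdt0l \<Gamma> \<Sigma> H"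
    unfolding hdt0l_def
  proof (intro conjI ballI)
    show "init_word H \<in> lists (work_alphabet H)"
      using T qs by (fastforce simp: H_def register_transducer_def)
  next
    fix c assume c: "c \<in> \<Gamma>"
    have "h c y \<in> lists (states T \<times> (\<Sigma> <+> registers T))"
      if "y \<in> states T \<times> (\<Sigma> <+> registers T)" for y
    proof -
      have "lift (snd (trans T q c)) x \<in> lists (\<Sigma> <+> registers T)"
        if "q \<in> states T" "x \<in> \<Sigma> <+> registers T" for q x
        using that T c unfolding register_transducer_def
        by (cases x) (auto simp: lift_def simp del: in_lists_conv_set)
      then show ?thesis
        using that qs(1) by (fastforce simp: h_def split: if_splits)
    qed
    then show "word_morphism (work_alphabet H) (work_alphabet H) (morphism H c)"
      unfolding H_def by (simp add: word_morphism_concat_map)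
  next
    have "config_value (init T, \<lambda>r. []) y \<in> lists \<Sigma>"
      if "y \<in> states T \<times> (\<Sigma> <+> registers T)" for y
      using that by (cases y) auto
    then show "word_morphism (work_alphabet H) \<Sigma> (final_morphism H)"
      unfolding H_def by (simp add: word_morphism_concat_map)
  qed (use T in \<open>auto simp: H_def register_transducer_def\<close>)
  moreover have "hdt0l_fun H w = transducer_fun T w" if w: "w \<in> lists \<Gamma>" for w
  proof -
    have letter: "concat (map (config_value (q, s)) (h c y)) = config_value (step T (q, s) c) y"
      if "q \<in> states T" for q s c y
    proof -
      obtain q' x where y: "y = (q', x)" by force
      have "concat (map (config_value (q, s)) (h c y)) =
          (if fst (trans T q c) = q' then subst s (lift (snd (trans T q c)) x) else [])"
        unfolding h_def y prod.case concat_map_concat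
        by (subst concat_map_singleton[where q = q])
          (use qs that in \<open>auto simp: concat_map_config_value_Pair simp del: map_map\<close>)
      also have "\<dots> = config_value (step T (q, s) c) y"
        by (auto simp: y lift_def subst_def split: prod.split sum.split)
      finally show ?thesis .
    qed
    have word: "concat (map (config_value (q, s)) (morphism H c v)) =
        concat (map (config_value (step T (q, s) c)) v)"
      if "q \<in> states T" for q s c v
      unfolding H_def using that by (simp add: concat_map_concat letter)
    \<comment> \<open>The first letter gives the outermost morphism, which \<open>word\<close>
      absorbs into the configuration; hence the induction needs arbitrary \<open>q\<close> and
      \<open>s\<close>.\<close>
    have run: "concat (map (config_value (q, s)) (foldr (morphism H) w d)) =
        concat (map (config_value (foldl (step T) (q, s) w)) d) \<and>
        fst (foldl (step T) (q, s) w) \<in> states T"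
      if "q \<in> states T" "w \<in> lists \<Gamma>" for q s w d
      using that
    proof (induction w arbitrary: q s)
      case (Cons c w)
      obtain q' s' where "step T (q, s) c = (q', s')" by force
      moreover have "fst (trans T q c) \<in> states T"
        using T Cons.prems by (simp add: register_transducer_def)
      ultimately have "q' \<in> states T"
        by (auto split: prod.splits)
      then show ?case
        using Cons word[OF Cons.prems(1)] \<open>step T (q, s) c = (q', s')\<close> by (simp del: step.simps)
    qed simp
    obtain q s where qs': "foldl (step T) (init T, \<lambda>r. []) w = (q, s)" by force
    have "init T \<in> states T" using T by (simp add: register_transducer_def)
    from run[OF this w, of "\<lambda>r. []"] have "q \<in> states T"
      and "hdt0l_fun H w = concat (map (config_value (q, s)) (init_word H))"
      by (simp_all add: qs' hdt0l_fun_def H_def)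
    moreover have "concat (map (config_value (q, s)) (init_word H)) = subst s (out T q)"
      unfolding H_def hdt0l.simps concat_map_concat
      by (subst concat_map_singleton[where q = q])
        (use qs \<open>q \<in> states T\<close> in \<open>auto simp: concat_map_config_value_Pair simp del: map_map\<close>)
    ultimately show ?thesis by (simp add: transducer_fun_def qs')
  qed
  ultimately show ?thesis
    using f by (intro hdt0l_specifiedI[of _ _ H]) simp_all
qed

section \<open>Squaring as a composition of two transducers\<close>

definition underlined_prefix :: "('a \<Rightarrow> 'a) \<Rightarrow> 'a list \<Rightarrow> nat \<Rightarrow> 'a list" where
  "underlined_prefix und w i = take i w @ [und (w ! i)]"

text \<open>For the input 123 this reads: \<open>und\<close> 3, 2, 1, \<open>und\<close> 2, 1,
  \<open>und\<close> 1.\<close>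

definition rev_prefixes :: "('a \<Rightarrow> 'a) \<Rightarrow> 'a list \<Rightarrow> 'a list" where
  "rev_prefixes und w = rev (concat (map (underlined_prefix und w) [0..<length w]))"

lemma rev_prefixes_Nil [simp]: "rev_prefixes und [] = []"
  by (simp add: rev_prefixes_def)

text \<open>Appending a letter leaves the earlier prefixes unchanged, and reversal puts the new,
  longest one in front. This recursion is the update of the output register in
  \<open>prefix_transducer\<close>.\<close>

lemma rev_prefixes_snoc [simp]:
  "rev_prefixes und (w @ [c]) = und c # rev w @ rev_prefixes und w"
proof -
  have "map (underlined_prefix und (w @ [c])) [0..<length w] =
      map (underlined_prefix und w) [0..<length w]"
    by (simp add: underlined_prefix_def nth_append)
  then have "rev_prefixes und (w @ [c]) =
      rev (underlined_prefix und (w @ [c]) (length w)) @ rev_prefixes und w"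
    by (simp add: rev_prefixes_def del: map_eq_conv)
  then show ?thesis by (simp add: underlined_prefix_def)
qed

text \<open>
  In both transducers below, \<^const>\<open>True\<close> is the output register and \<^const>\<open>False\<close> the register
  that holds the reversed prefix, respectively the suffix, to be copied.
\<close>

definition prefix_transducer :: "('a \<Rightarrow> 'a) \<Rightarrow> (unit, bool, 'a, 'a) register_transducer" where
  "prefix_transducer und = \<lparr>states = UNIV, init = (), registers = UNIV,
     trans = (\<lambda>_ c. ((), \<lambda>r. if r then [Inl (und c), Inr False, Inr True]
       else [Inl c, Inr False])),
     out = (\<lambda>_. [Inr True])\<rparr>"

definition suffix_transducer ::
    "'a set \<Rightarrow> ('a \<Rightarrow> 'a) \<Rightarrow> (unit, bool, 'a, 'a) register_transducer" where
  "suffix_transducer \<Gamma> und = \<lparr>states = UNIV, init = (), registers = UNIV,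
     trans = (\<lambda>_ c. ((), \<lambda>r.
       if c \<in> \<Gamma> then (if r then [Inl c, Inr True] else [Inr False])
       else (if r then [Inl c, Inr False, Inr True]
         else [Inl (inv_into \<Gamma> und c), Inr False]))),
     out = (\<lambda>_. [Inr True])\<rparr>"

lemma register_transducer_prefix_transducer:
  assumes "finite \<Gamma>"
  shows "register_transducer \<Gamma> (\<Gamma> \<union> und ` \<Gamma>) (prefix_transducer und)"
  using assms by (auto simp: register_transducer_def prefix_transducer_def)

lemma register_transducer_suffix_transducer:
  assumes "finite \<Gamma>"
  shows "register_transducer (\<Gamma> \<union> und ` \<Gamma>) (\<Gamma> \<union> und ` \<Gamma>) (suffix_transducer \<Gamma> und)"
  using assms by (auto simp: register_transducer_def suffix_transducer_def inv_into_into)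

lemma prefix_transducer_fun: "transducer_fun (prefix_transducer und) w = rev_prefixes und w"
proof -
  have "foldl (step (prefix_transducer und)) ((), \<lambda>r. []) w =
      ((), \<lambda>r. if r then rev_prefixes und w else rev w)"
    by (induction w rule: rev_induct) (auto simp: prefix_transducer_def subst_def fun_eq_iff)
  then show ?thesis
    by (simp add: transducer_fun_def prefix_transducer_def subst_def)
qed

text \<open>Plain letters are prepended one by one, which undoes the reversal of a prefix; the
  stored suffix is untouched.\<close>

lemma suffix_transducer_plain:
  assumes "v \<in> lists \<Gamma>"
  shows "foldl (step (suffix_transducer \<Gamma> und)) ((), \<lambda>r. if r then x else y) v =
    ((), \<lambda>r. if r then rev v @ x else y)"
  using assms
proof (induction v arbitrary: x)
  case (Cons c v)
  have "step (suffix_transducer \<Gamma> und) ((), \<lambda>r. if r then x else y) c =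
      ((), \<lambda>r. if r then c # x else y)"
    using Cons.hyps by (auto simp: suffix_transducer_def subst_def fun_eq_iff)
  then show ?case using Cons by (simp add: fun_eq_iff del: step.simps)
qed (simp add: fun_eq_iff)

text \<open>Downward induction on \<open>k\<close>: once the prefixes with index at least
  \<open>k\<close> are read, the output register holds their completed blocks and the other register
  holds \<open>drop k w\<close>. At the next underlined letter this is exactly the missing
  suffix.\<close>

lemma suffix_transducer_fun:
  assumes und: "inj_on und \<Gamma>" "und ` \<Gamma> \<inter> \<Gamma> = {}" and w: "w \<in> lists \<Gamma>"
  shows "transducer_fun (suffix_transducer \<Gamma> und) (rev_prefixes und w) = squaring und w"
proof -
  let ?T = "suffix_transducer \<Gamma> und"
  let ?sq = "\<lambda>i. take i w @ [und (w ! i)] @ drop (Suc i) w"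
  have "foldl (step ?T) ((), \<lambda>r. []) (rev (concat (map (underlined_prefix und w) [k..<length w]))) =
      ((), \<lambda>r. if r then concat (map ?sq [k..<length w]) else drop k w)"
    if "k \<le> length w" for k
    using that
  proof (induction rule: inc_induct)
    case (step k)
    have k: "w ! k \<in> \<Gamma>" and plain: "rev (take k w) \<in> lists \<Gamma>"
      using w step.hyps by (auto simp: in_lists_conv_set dest: in_set_takeD)
    \<comment> \<open>Disjointness lets the transducer recognise an underlined letter; injectivity
      lets \<open>inv_into\<close> recover \<open>w ! k\<close> for the stored suffix.\<close>
    then have "und (w ! k) \<notin> \<Gamma>" using und(2) by blast
    then have "Defs.step ?T ((), \<lambda>r. if r then x else y) (und (w ! k)) =
        ((), \<lambda>r. if r then und (w ! k) # y @ x else w ! k # y)" for x y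
      using k und(1) by (auto simp: suffix_transducer_def subst_def fun_eq_iff)
    with step show ?case
      by (simp add: upt_conv_Cons underlined_prefix_def suffix_transducer_plain[OF plain]
          del: step.simps)
        (simp add: fun_eq_iff upt_conv_Cons Cons_nth_drop_Suc)
  qed (simp add: fun_eq_iff)
  from this[of 0] show ?thesis
    by (simp add: transducer_fun_def rev_prefixes_def squaring_def)
      (simp add: suffix_transducer_def subst_def)
qed

section \<open>Composition of chains and conclusion\<close>

text \<open>The inductive rule only adds one function at the start of a chain, so joining two chains
  works like list append, by induction on the first.\<close>

lemma finite_composition_trans:
  assumes "finite_composition C \<Gamma> \<Delta> f" "finite_composition C \<Delta> \<Sigma> g"
    and "\<forall>w\<in>lists \<Gamma>. h w = g (f w)"
  shows "finite_composition C \<Gamma> \<Sigma> h"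
  using assms
proof (induction arbitrary: h)
  case (single \<Gamma> \<Delta> f)
  then show ?case by (rule finite_composition.comp)
next
  case (comp \<Gamma> \<Delta>' f \<Delta> g' f')
  \<comment> \<open>Reassociation: the tail of the first chain is joined to the second chain before
    \<open>f\<close> is put back in front.\<close>
  have "finite_composition C \<Delta>' \<Sigma> (\<lambda>v. g (g' v))"
    by (rule comp.IH) (simp_all add: comp.prems(1))
  then show ?case
    by (rule finite_composition.comp[where f = f, rotated])
      (simp_all add: comp.hyps comp.prems)
qed

theorem theorem20:
  fixes \<Gamma> \<Sigma> :: "'a::infinite set" and f :: "'a list \<Rightarrow> 'a list"
  assumes "polyregular \<Gamma> \<Sigma> f"
  shows "finite_composition hdt0l_specified \<Gamma> \<Sigma> f"
  using assms
proof induction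
  case (regular \<Gamma> \<Sigma> f)
  then obtain T :: "(nat, nat, 'a, 'a) register_transducer" where
    "register_transducer \<Gamma> \<Sigma> T" "\<And>w. w \<in> lists \<Gamma> \<Longrightarrow> f w = transducer_fun T w"
    unfolding regular_def sst_def by blast
  then show ?case
    by (intro finite_composition.single register_transducer_hdt0l_specified)
next
  case (squaring \<Gamma> und f)
  have "hdt0l_specified \<Gamma> (\<Gamma> \<union> und ` \<Gamma>) (rev_prefixes und)"
    using register_transducer_prefix_transducer[OF squaring(1)]
    by (rule register_transducer_hdt0l_specified) (simp add: prefix_transducer_fun)
  moreover have "hdt0l_specified (\<Gamma> \<union> und ` \<Gamma>) (\<Gamma> \<union> und ` \<Gamma>)
      (transducer_fun (suffix_transducer \<Gamma> und))"
    using register_transducer_suffix_transducer[OF squaring(1)]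
    by (rule register_transducer_hdt0l_specified) simp
  ultimately show ?case
    by (rule finite_composition.comp[OF _ finite_composition.single])
      (simp add: squaring suffix_transducer_fun)
next
  case (comp \<Gamma> \<Delta> f \<Sigma> g h)
  then show ?case by (blast intro: finite_composition_trans)
qed

end
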